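(* Let $n,k,t,r\in\mathbb N$ be such that $2\le k\le n$ and $n=t(k-1)+r$ where $0\le r\le k-2$. Then $t\ge 1$, $g=(k,1^{[n-k]})\in\mathcal J(\mathcal L_n)$, $m=((k-1)^{[t]},r)\in\mathcal M(\mathcal L_n)$, and both $g\swarrow m$ and $g\nearrow m$ hold. Moreover, if $g\in\mathcal J(\mathcal L_n)$ is of type C and $m\in\mathcal M(\mathcal L_n)$ satisfies both $g\swarrow m$ and $g\nearrow m$, then $g$ and $m$ are of the shape just described, i.e. $g=(k,1^{[n-k]})$ and $m=((k-1)^{[t]},r)$ for some $k,t,r\in\mathbb N$ with $2\le k\le n$, $n=t(k-1)+r$ and $0\le r\le k-2$.
   Context: $\mathbb N=\{0,1,2,\dots\}$. A partition of $n\in\mathbb N$ is a tuple $(a_1,\dots,a_n)$ of natural numbers with $a_1\ge\dots\ge a_n\ge 0$ and $\sum a_i=n$; trailing zeros may be omitted or added. $x^{[s]}$ denotes $s$ consecutive entries equal to $x$ (no entry if $s=0$). $\mathcal L_n$ is the finite lattice of all partitions of $n$ under the dominance order: $a\le b$ iff $\sum_{i=1}^j a_i\le\sum_{i=1}^j b_i$ for all $1\le j\le n$. $\mathcal J(\mathcal L_n)$ is the set of (completely) join-irreducible elements (not the least element, and $x=y\vee z$ implies $x=y$ or $x=z$); $\mathcal M(\mathcal L_n)$ is the set of (completely) meet-irreducible elements (not the greatest element, and $x=y\wedge z$ implies $x=y$ or $x=z$). Arrow relations of the standard context $(\mathcal J(\mathcal L_n),\mathcal M(\mathcal L_n),\le)$: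 for $g\in\mathcal J(\mathcal L_n)$ and $m\in\mathcal M(\mathcal L_n)$ put $g'=\{y\in\mathcal M(\mathcal L_n): g\le y\}$ and $m'=\{y\in\mathcal J(\mathcal L_n): y\le m\}$. Then $g\swarrow m$ iff $g\nleq m$ and for all $h\in\mathcal J(\mathcal L_n)$ with $g'\subsetneq h'$ we have $h\le m$; and $g\nearrow m$ iff $g\nleq m$ and for all $y\in\mathcal M(\mathcal L_n)$ with $m'\subsetneq y'$ we have $g\le y$. A partition of $n$ in $\mathcal J(\mathcal L_n)$ is of type C if it is $(k,1^{[d]})$ with $k\ge3$, $d\ge1$. *)

theory Defs
  imports "HOL-Algebra.Lattice" "HOL-Library.More_List"
begin

definition partitions :: "nat \<Rightarrow> nat list set" where
  "partitions n = {a. length a = n \<and> sorted_wrt (\<ge>) a \<and> sum_list a = n}"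

(* Trailing zeros are omitted or added so as to reach length n; nonzero entries are never
   dropped, so a list with more than n entries after stripping does not give a partition of n. *)
definition padded :: "nat \<Rightarrow> nat list \<Rightarrow> nat list" where
  "padded n xs = (let ys = strip_while (\<lambda>x. x = 0) xs in ys @ replicate (n - length ys) 0)"

definition dominance_le :: "nat \<Rightarrow> nat list \<Rightarrow> nat list \<Rightarrow> bool" where
  "dominance_le n a b \<longleftrightarrow> (\<forall>j\<in>{1..n}. sum_list (take j a) \<le> sum_list (take j b))"

definition dominance_lattice :: "nat \<Rightarrow> nat list gorder" where
  "dominance_lattice n = \<lparr>carrier = partitions n, eq = (=), le = dominance_le n\<rparr>"

(* The binary conditions below agree with complete irreducibility in finite lattices,
   the only case in which they are used. *)
definition join_irreducibles :: "('a, 'b) gorder_scheme \<Rightarrow> 'a set" where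
  "join_irreducibles L = {x \<in> carrier L. \<not> least L x (carrier L) \<and>
     (\<forall>y\<in>carrier L. \<forall>z\<in>carrier L. x = y \<squnion>\<^bsub>L\<^esub> z \<longrightarrow> x = y \<or> x = z)}"

definition meet_irreducibles :: "('a, 'b) gorder_scheme \<Rightarrow> 'a set" where
  "meet_irreducibles L = {x \<in> carrier L. \<not> greatest L x (carrier L) \<and>
     (\<forall>y\<in>carrier L. \<forall>z\<in>carrier L. x = y \<sqinter>\<^bsub>L\<^esub> z \<longrightarrow> x = y \<or> x = z)}"

(* Derivations in the standard context of L.  An element can be both join- and
   meet-irreducible, so the two primes of the usual notation need two names. *)
definition obj_prime :: "('a, 'b) gorder_scheme \<Rightarrow> 'a \<Rightarrow> 'a set" where
  "obj_prime L g = {y \<in> meet_irreducibles L. g \<sqsubseteq>\<^bsub>L\<^esub> y}"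

definition attr_prime :: "('a, 'b) gorder_scheme \<Rightarrow> 'a \<Rightarrow> 'a set" where
  "attr_prime L m = {y \<in> join_irreducibles L. y \<sqsubseteq>\<^bsub>L\<^esub> m}"

(* The arrow relations are meant for a join-irreducible g and a meet-irreducible m. *)
definition arrow_down :: "('a, 'b) gorder_scheme \<Rightarrow> 'a \<Rightarrow> 'a \<Rightarrow> bool" where
  "arrow_down L g m \<longleftrightarrow> \<not> g \<sqsubseteq>\<^bsub>L\<^esub> m \<and>
     (\<forall>h\<in>join_irreducibles L. obj_prime L g \<subset> obj_prime L h \<longrightarrow> h \<sqsubseteq>\<^bsub>L\<^esub> m)"

definition arrow_up :: "('a, 'b) gorder_scheme \<Rightarrow> 'a \<Rightarrow> 'a \<Rightarrow> bool" where
  "arrow_up L g m \<longleftrightarrow> \<not> g \<sqsubseteq>\<^bsub>L\<^esub> m \<and>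
     (\<forall>y\<in>meet_irreducibles L. attr_prime L m \<subset> attr_prime L y \<longrightarrow> g \<sqsubseteq>\<^bsub>L\<^esub> y)"

definition type_C :: "nat \<Rightarrow> nat list \<Rightarrow> bool" where
  "type_C n g \<longleftrightarrow> g \<in> join_irreducibles (dominance_lattice n) \<and>
     (\<exists>k d. k \<ge> 3 \<and> d \<ge> 1 \<and> g = padded n (k # replicate d 1))"

end

(* The partition g = (k, 1, ..., 1) is the least partition of n whose first entry is at least k,
   and m = (k - 1, ..., k - 1, r) is the greatest one whose first entry is at most k - 1.  So every
   partition lies either above g or below m and never both: (g, m) splits the lattice.  In any
   lattice the two members of such a splitting pair are irreducible and doubly arrow-related, and
   by join-density of the join-irreducibles in a finite lattice, m is the only meet-irreducible
   element with an up-arrow from g. *)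

theory Submission
  imports Defs "HOL-Algebra.Complete_Lattice"
begin

section \<open>Splitting pairs\<close>

text \<open>The carrier is the disjoint union of the principal filter of \<open>g\<close> and the
  principal ideal of \<open>m\<close>. In a lattice this makes \<open>g\<close> join-prime and
  \<open>m\<close> meet-prime.\<close>

definition splitting_pair :: "('a, 'b) gorder_scheme \<Rightarrow> 'a \<Rightarrow> 'a \<Rightarrow> bool" where
  "splitting_pair L g m \<longleftrightarrow> g \<in> carrier L \<and> m \<in> carrier L \<and>
     (\<forall>x\<in>carrier L. g \<sqsubseteq>\<^bsub>L\<^esub> x \<longleftrightarrow> \<not> x \<sqsubseteq>\<^bsub>L\<^esub> m)"

lemma (in partial_order) splitting_pair_not_le:
  assumes "splitting_pair L g m"
  shows "\<not> g \<sqsubseteq> m"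
  using assms by (auto simp: splitting_pair_def)

text \<open>If \<open>y\<close> and \<open>z\<close> were both below \<open>m\<close>, so would be
  their join \<open>g\<close>. Hence one of them lies above \<open>g\<close>, and it is also below
  \<open>g\<close> because \<open>g\<close> is their join.\<close>

lemma (in lattice) splitting_pair_join_irreducible:
  assumes "splitting_pair L g m"
  shows "g \<in> join_irreducibles L"
proof -
  have g: "g \<in> carrier L" and m: "m \<in> carrier L"
    and split: "\<And>x. x \<in> carrier L \<Longrightarrow> g \<sqsubseteq> x \<longleftrightarrow> \<not> x \<sqsubseteq> m"
    using assms by (auto simp: splitting_pair_def)
  have "\<not> least L g (carrier L)"
    using splitting_pair_not_le[OF assms] m by (auto simp: least_def)
  moreover have "g = y \<or> g = z"
    if y: "y \<in> carrier L" and z: "z \<in> carrier L" and eq: "g = y \<squnion> z" for y z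
  proof -
    have "\<not> y \<sqsubseteq> m \<or> \<not> z \<sqsubseteq> m"
      using join_le[OF _ _ y z m] splitting_pair_not_le[OF assms] eq by auto
    then have "g \<sqsubseteq> y \<or> g \<sqsubseteq> z"
      using split y z by auto
    moreover have "y \<sqsubseteq> g" "z \<sqsubseteq> g"
      using join_left[OF y z] join_right[OF y z] eq by auto
    ultimately show ?thesis
      using g y z le_antisym by blast
  qed
  ultimately show ?thesis
    using g by (auto simp: join_irreducibles_def)
qed

text \<open>Dually, \<open>y\<close> and \<open>z\<close> cannot both lie above \<open>g\<close>,
  since then their meet \<open>m\<close> would.\<close>

lemma (in lattice) splitting_pair_meet_irreducible:
  assumes "splitting_pair L g m"
  shows "m \<in> meet_irreducibles L"
proof -
  have g: "g \<in> carrier L" and m: "m \<in> carrier L"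
    and split: "\<And>x. x \<in> carrier L \<Longrightarrow> g \<sqsubseteq> x \<longleftrightarrow> \<not> x \<sqsubseteq> m"
    using assms by (auto simp: splitting_pair_def)
  have "\<not> greatest L m (carrier L)"
    using splitting_pair_not_le[OF assms] g by (auto simp: greatest_def)
  moreover have "m = y \<or> m = z"
    if y: "y \<in> carrier L" and z: "z \<in> carrier L" and eq: "m = y \<sqinter> z" for y z
  proof -
    have "\<not> g \<sqsubseteq> y \<or> \<not> g \<sqsubseteq> z"
      using meet_le[OF _ _ y z g] splitting_pair_not_le[OF assms] eq by auto
    then have "y \<sqsubseteq> m \<or> z \<sqsubseteq> m"
      using split y z by auto
    moreover have "m \<sqsubseteq> y" "m \<sqsubseteq> z"
      using meet_left[OF y z] meet_right[OF y z] eq by auto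
    ultimately show ?thesis
      using m y z le_antisym by blast
  qed
  ultimately show ?thesis
    using m by (auto simp: meet_irreducibles_def)
qed

lemma (in partial_order) obj_prime_mono:
  assumes "g \<in> carrier L" "h \<in> carrier L" "g \<sqsubseteq> h"
  shows "obj_prime L h \<subseteq> obj_prime L g"
  using assms le_trans by (auto simp: obj_prime_def meet_irreducibles_def)

lemma (in partial_order) attr_prime_mono:
  assumes "m \<in> carrier L" "y \<in> carrier L" "m \<sqsubseteq> y"
  shows "attr_prime L m \<subseteq> attr_prime L y"
  using assms le_trans by (auto simp: attr_prime_def join_irreducibles_def)

text \<open>An \<open>h\<close> not below \<open>m\<close> lies above \<open>g\<close>, so
  \<open>obj_prime L h\<close> is contained in \<open>obj_prime L g\<close> and cannot strictly
  contain it.\<close>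

lemma (in partial_order) splitting_pair_arrow_down:
  assumes "splitting_pair L g m"
  shows "arrow_down L g m"
proof -
  have "h \<sqsubseteq> m" if h: "h \<in> join_irreducibles L" and sub: "obj_prime L g \<subset> obj_prime L h" for h
  proof (rule ccontr)
    assume "\<not> h \<sqsubseteq> m"
    moreover have "h \<in> carrier L" "g \<in> carrier L"
      using h assms by (auto simp: join_irreducibles_def splitting_pair_def)
    ultimately have "obj_prime L h \<subseteq> obj_prime L g"
      using assms obj_prime_mono by (auto simp: splitting_pair_def)
    with sub show False by blast
  qed
  then show ?thesis
    using splitting_pair_not_le[OF assms] by (auto simp: arrow_down_def)
qed

lemma (in partial_order) splitting_pair_arrow_up:
  assumes "splitting_pair L g m"
  shows "arrow_up L g m"
proof -
  have "g \<sqsubseteq> y" if y: "y \<in> meet_irreducibles L" and sub: "attr_prime L m \<subset> attr_prime L y" for y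
  proof (rule ccontr)
    assume "\<not> g \<sqsubseteq> y"
    moreover have "y \<in> carrier L" "m \<in> carrier L"
      using y assms by (auto simp: meet_irreducibles_def splitting_pair_def)
    ultimately have "attr_prime L y \<subseteq> attr_prime L m"
      using assms attr_prime_mono by (auto simp: splitting_pair_def)
    with sub show False by blast
  qed
  then show ?thesis
    using splitting_pair_not_le[OF assms] by (auto simp: arrow_up_def)
qed

text \<open>Join-density of the join-irreducibles: an element minimal among those below
  \<open>a\<close> but not below \<open>b\<close> is join-irreducible, because everything strictly
  below it is below \<open>b\<close>.\<close>

lemma (in lattice) join_irreducibles_separate:
  assumes fin: "finite (carrier L)"
    and a: "a \<in> carrier L" and b: "b \<in> carrier L" and nle: "\<not> a \<sqsubseteq> b"
  obtains h where "h \<in> join_irreducibles L" "h \<sqsubseteq> a" "\<not> h \<sqsubseteq> b"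
proof -
  let ?P = "\<lambda>h. h \<in> carrier L \<and> h \<sqsubseteq> a \<and> \<not> h \<sqsubseteq> b"
  let ?down = "\<lambda>h. {x \<in> carrier L. x \<sqsubseteq> h}"
  have "?P a"
    using a nle by simp
  \<comment> \<open>The size of the principal ideal is strictly monotone on the finite carrier, so
    minimizing it yields an order-minimal element.\<close>
  then obtain h where h: "?P h" and min: "\<And>y. ?P y \<Longrightarrow> card (?down h) \<le> card (?down y)"
    using ex_has_least_nat[of ?P a "\<lambda>h. card (?down h)"] by blast
  have min': "y \<sqsubseteq> b" if y: "y \<in> carrier L" and yh: "y \<sqsubseteq> h" and "y \<noteq> h" for y
  proof (rule ccontr)
    assume "\<not> y \<sqsubseteq> b"
    with h y yh a have "?P y"
      using le_trans by blast
    moreover have "?down y \<subset> ?down h"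
    proof
      show "?down y \<subseteq> ?down h"
        using h y yh le_trans by blast
      have "\<not> h \<sqsubseteq> y"
        using h y yh \<open>y \<noteq> h\<close> le_antisym by blast
      then show "?down y \<noteq> ?down h"
        using h by blast
    qed
    then have "card (?down y) < card (?down h)"
      using fin by (intro psubset_card_mono) auto
    ultimately show False
      using min by fastforce
  qed
  have "\<not> least L h (carrier L)"
    using h b by (auto simp: least_def)
  moreover have "h = y \<or> h = z"
    if y: "y \<in> carrier L" and z: "z \<in> carrier L" and eq: "h = y \<squnion> z" for y z
  proof (rule ccontr)
    assume "\<not> (h = y \<or> h = z)"
    then have "y \<sqsubseteq> b" "z \<sqsubseteq> b"
      using min'[OF y] min'[OF z] join_left[OF y z] join_right[OF y z] eq by auto
    then have "h \<sqsubseteq> b"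
      using join_le y z b eq by blast
    with h show False by blast
  qed
  ultimately have "h \<in> join_irreducibles L"
    using h by (auto simp: join_irreducibles_def)
  with h that show thesis by blast
qed

text \<open>The arrow keeps \<open>m'\<close> from lying above \<open>g\<close>, so the splitting
  puts it below \<open>m\<close>. Were it strictly below, join-density would make
  \<open>attr_prime L m'\<close> a proper subset of \<open>attr_prime L m\<close>, and the arrow
  would force \<open>g\<close> below \<open>m\<close>.\<close>

lemma (in lattice) splitting_pair_arrow_up_unique:
  assumes fin: "finite (carrier L)" and split: "splitting_pair L g m"
    and m': "m' \<in> meet_irreducibles L" and arrow: "arrow_up L g m'"
  shows "m' = m"
proof (rule ccontr)
  assume neq: "m' \<noteq> m"
  have m: "m \<in> meet_irreducibles L"
    using splitting_pair_meet_irreducible[OF split] .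
  have carrier: "m \<in> carrier L" "m' \<in> carrier L"
    using m m' by (auto simp: meet_irreducibles_def)
  have le: "m' \<sqsubseteq> m"
    using arrow split carrier by (auto simp: arrow_up_def splitting_pair_def)
  then have "\<not> m \<sqsubseteq> m'"
    using neq carrier le_antisym by blast
  then obtain h where "h \<in> join_irreducibles L" "h \<sqsubseteq> m" "\<not> h \<sqsubseteq> m'"
    using join_irreducibles_separate[OF fin] carrier by blast
  then have "attr_prime L m' \<subset> attr_prime L m"
    using attr_prime_mono[OF carrier(2,1) le] by (auto simp: attr_prime_def)
  then show False
    using arrow m splitting_pair_not_le[OF split] by (auto simp: arrow_up_def)
qed

section \<open>The dominance lattice\<close>

lemma dominance_lattice_simps [simp]:
  "carrier (dominance_lattice n) = partitions n"
  "eq (dominance_lattice n) = (=)"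
  "le (dominance_lattice n) = dominance_le n"
  by (simp_all add: dominance_lattice_def)

lemma finite_partitions: "finite (partitions n)"
proof (rule finite_subset)
  show "partitions n \<subseteq> {xs. set xs \<subseteq> {..n} \<and> length xs = n}"
    using member_le_sum_list[where ?'a = nat] by (fastforce simp: partitions_def)
  show "finite {xs. set xs \<subseteq> {..n} \<and> length xs = n}"
    by (intro finite_lists_length_eq) simp
qed

lemma sum_list_take_Suc:
  assumes "j < length xs"
  shows "sum_list (take (Suc j) xs) = sum_list (take j xs) + (xs ! j :: 'a :: monoid_add)"
  using assms by (simp add: take_Suc_conv_app_nth)

lemma partitions_sum_take_drop:
  assumes "x \<in> partitions n"
  shows "sum_list (take j x) + sum_list (drop j x) = n"
  using assms by (simp add: partitions_def flip: sum_list_append)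

lemma partitions_sum_take_le:
  assumes "x \<in> partitions n"
  shows "sum_list (take j x) \<le> n"
  using partitions_sum_take_drop[OF assms, of j] by simp

lemma partitions_sum_take_all:
  assumes "x \<in> partitions n"
  shows "sum_list (take n x) = n"
  using assms by (simp add: partitions_def)

lemma partitions_nth_antimono:
  assumes "x \<in> partitions n" "i \<le> j" "j < n"
  shows "x ! j \<le> x ! i"
  using assms by (cases "i = j") (auto simp: partitions_def sorted_wrt_iff_nth_less)

text \<open>The increments of the partial sums are the entries, which decrease weakly. The additive
  form avoids truncated subtraction.\<close>

lemma partitions_sum_take_concave:
  assumes x: "x \<in> partitions n" and j: "Suc j < n"
  shows "sum_list (take j x) + sum_list (take (Suc (Suc j)) x) \<le> 2 * sum_list (take (Suc j) x)"
  using partitions_nth_antimono[OF x, of j "Suc j"] sum_list_take_Suc[of j x]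
    sum_list_take_Suc[of "Suc j" x] x j
  by (simp add: partitions_def)

lemma dominance_le_antisym:
  assumes a: "a \<in> partitions n" and b: "b \<in> partitions n"
    and "dominance_le n a b" "dominance_le n b a"
  shows "a = b"
proof (rule nth_equalityI)
  show "length a = length b"
    using a b by (simp add: partitions_def)
  \<comment> \<open>The order compares only from \<open>j = 1\<close> on; the trivial case
    \<open>j = 0\<close> is added so that the first entry too is a difference of partial
    sums.\<close>
  have eq: "sum_list (take j a) = sum_list (take j b)" if "j \<le> n" for j
    using that assms(3,4) by (cases j) (auto simp: dominance_le_def intro!: le_antisym)
  show "a ! i = b ! i" if "i < length a" for i
    using that eq[of i] eq[of "Suc i"] sum_list_take_Suc[of i a] sum_list_take_Suc[of i b] a b
    by (simp add: partitions_def)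
qed

lemma partial_order_dominance_lattice: "partial_order (dominance_lattice n)"
proof -
  have "weak_partial_order (dominance_lattice n)"
  proof
    show "x .=\<^bsub>dominance_lattice n\<^esub> y"
      if "x \<sqsubseteq>\<^bsub>dominance_lattice n\<^esub> y" "y \<sqsubseteq>\<^bsub>dominance_lattice n\<^esub> x"
        "x \<in> carrier (dominance_lattice n)" "y \<in> carrier (dominance_lattice n)" for x y
      using dominance_le_antisym that by simp
  qed (auto simp: dominance_le_def intro: order_trans)
  then show ?thesis
    by (simp add: partial_order_def partial_order_axioms_def)
qed

text \<open>The infimum has the pointwise minimum of the partial sums as its partial sums: these are
  increasing and concave, because a pointwise minimum of concave functions is concave.\<close>

lemma dominance_inf_exists:
  assumes A: "A \<subseteq> partitions n" and ne: "A \<noteq> {}"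
  shows "\<exists>i. greatest (dominance_lattice n) i (Lower (dominance_lattice n) A)"
proof -
  define S where "S j = (INF a\<in>A. sum_list (take j a))" for j
  \<comment> \<open>The truncated subtraction is exact because \<open>S\<close> is increasing
    (\<open>S_mono\<close>).\<close>
  define b where "b = map (\<lambda>j. S (Suc j) - S j) [0..<n]"
  have S_le: "S j \<le> sum_list (take j a)" if "a \<in> A" for a j
    unfolding S_def using that by (intro cINF_lower) auto
  \<comment> \<open>An infimum of a nonempty set of naturals is attained, so each property of
    \<open>S\<close> can be read off from one member of \<open>A\<close> chosen for a suitable
    index.\<close>
  have S_attained: "\<exists>a\<in>A. S j = sum_list (take j a)" for j
    using Inf_nat_def1[of "(\<lambda>a. sum_list (take j a)) ` A"] ne by (auto simp: S_def)
  have S_n: "S n = n"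
    using S_attained[of n] A partitions_sum_take_all by force
  have S_0: "S 0 = 0"
    using S_attained[of 0] by simp
  have S_mono: "S j \<le> S (Suc j)" for j
  proof -
    obtain a where a: "a \<in> A" "S (Suc j) = sum_list (take (Suc j) a)"
      using S_attained by blast
    have "sum_list (take j a) \<le> sum_list (take (Suc j) a)"
      by (cases "j < length a") (simp_all add: sum_list_take_Suc)
    with S_le[OF a(1), of j] a(2) show ?thesis by simp
  qed
  have S_concave: "S j + S (Suc (Suc j)) \<le> 2 * S (Suc j)" if "Suc j < n" for j
  proof -
    \<comment> \<open>The member to choose is the one attaining the middle value: its outer partial
      sums bound those of \<open>S\<close> from above.\<close>
    obtain a where a: "a \<in> A" "S (Suc j) = sum_list (take (Suc j) a)"
      using S_attained by blast
    with A have "a \<in> partitions n" by blast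
    then show ?thesis
      using partitions_sum_take_concave[OF _ that, of a] S_le[OF a(1), of j]
        S_le[OF a(1), of "Suc (Suc j)"] a(2) by simp
  qed
  have len: "length b = n"
    by (simp add: b_def)
  have sum_b: "sum_list (take j b) = S j" if "j \<le> n" for j
    using that
  proof (induction j)
    case 0
    then show ?case by (simp add: S_0)
  next
    case (Suc j)
    then show ?case
      using S_mono[of j] by (simp add: sum_list_take_Suc len) (simp add: b_def)
  qed
  have "b ! j \<le> b ! i" if "i < j" "j < n" for i j
    using that
  proof (induction j rule: less_induct)
    case (less j)
    then obtain l where l: "j = Suc l"
      by (cases j) auto
    with less.prems have "b ! j \<le> b ! l"
      using S_concave[of l] S_mono[of l] S_mono[of "Suc l"] by (simp add: b_def)
    moreover have "b ! l \<le> b ! i"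
      using less l by (cases "i = l") auto
    ultimately show ?case by simp
  qed
  then have "sorted_wrt (\<ge>) b"
    by (simp add: sorted_wrt_iff_nth_less len)
  with len sum_b[of n] S_n have b: "b \<in> partitions n"
    by (simp add: partitions_def)
  have "greatest (dominance_lattice n) b (Lower (dominance_lattice n) A)"
  proof -
    have "dominance_le n b a" if "a \<in> A" for a
      using S_le[OF that] sum_b by (auto simp: dominance_le_def)
    moreover have "dominance_le n c b" if c: "\<forall>a. a \<in> A \<longrightarrow> dominance_le n c a" for c
      unfolding dominance_le_def
    proof
      fix j assume j: "j \<in> {1..n}"
      obtain a where "a \<in> A" "S j = sum_list (take j a)"
        using S_attained by blast
      with c j sum_b[of j] show "sum_list (take j c) \<le> sum_list (take j b)"
        by (auto simp: dominance_le_def)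
    qed
    ultimately show ?thesis
      using b A by (auto simp: greatest_def Lower_def)
  qed
  then show ?thesis by blast
qed

section \<open>Padded lists\<close>

text \<open>Only trailing zeros change, so dominance can be computed from the unpadded list, also
  for \<open>j\<close> past its end.\<close>

lemma sum_list_take_padded: "sum_list (take j (padded n xs)) = sum_list (take j xs)"
proof -
  obtain ys zs where ys: "strip_while (\<lambda>x. x = 0) xs = ys"
    and zs: "\<forall>x\<in>set zs. x = 0" and xs: "xs = ys @ zs"
    by (rule split_strip_while_append)
  have "sum_list (take i zs) = 0" for i
    using zs by (auto simp: sum_list_eq_0_iff dest: in_set_takeD)
  then show ?thesis
    unfolding padded_def ys by (simp add: xs sum_list_replicate)
qed

text \<open>Once the zeros are stripped, the last entry and hence every entry is at least 1, so
  there are at most \<open>n\<close> of them and the padding ends at length exactly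
  \<open>n\<close>.\<close>

lemma padded_in_partitions:
  assumes sorted: "sorted_wrt (\<ge>) xs" and sum: "sum_list xs = n"
  shows "padded n xs \<in> partitions n"
proof -
  obtain ys zs where ys: "strip_while (\<lambda>x. x = 0) xs = ys"
    and zs: "\<forall>x\<in>set zs. x = 0" and xs: "xs = ys @ zs"
    by (rule split_strip_while_append)
  have sorted_ys: "sorted_wrt (\<ge>) ys" and sum_ys: "sum_list ys = n"
    using sorted sum zs xs sum_list_eq_0_iff[of zs] by (auto simp: sorted_wrt_append)
  have pos: "\<forall>y\<in>set ys. 1 \<le> y"
  proof (cases ys rule: rev_cases)
    case (snoc us u)
    have "no_trailing (\<lambda>x. x = 0) ys"
      using ys by auto
    then have "1 \<le> u"
      by (simp add: snoc)
    then show ?thesis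
      using sorted_ys by (fastforce simp: snoc sorted_wrt_append)
  qed simp
  have "length ys \<le> n"
    using sum_list_mono[of ys "\<lambda>_. 1" "\<lambda>y. y"] pos sum_ys by (simp add: sum_list_triv)
  then show ?thesis
    using sorted_ys sum_ys ys
    by (auto simp: padded_def partitions_def sorted_wrt_append sum_list_replicate
        sorted_wrt_iff_nth_less[of _ "replicate _ _"])
qed

text \<open>A greatest element and infima of nonempty subsets suffice. The partition
  \<open>[n]\<close> is greatest: its partial sums from the first on all equal
  \<open>n\<close>.\<close>

lemma complete_lattice_dominance_lattice: "complete_lattice (dominance_lattice n)"
proof (rule partial_order.complete_lattice_criterion1[OF partial_order_dominance_lattice])
  have "padded n [n] \<in> partitions n"
    by (rule padded_in_partitions) simp_all
  moreover have "dominance_le n x (padded n [n])" if "x \<in> partitions n" for x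
    using partitions_sum_take_le[OF that]
    by (auto simp: dominance_le_def sum_list_take_padded take_Cons')
  ultimately have "greatest (dominance_lattice n) (padded n [n]) (carrier (dominance_lattice n))"
    by (simp add: greatest_def)
  then show "\<exists>g. greatest (dominance_lattice n) g (carrier (dominance_lattice n))"
    by blast
qed (simp add: dominance_inf_exists)

section \<open>Splitting the dominance lattice by the first entry\<close>

text \<open>After a zero entry only zeros follow, so the whole sum is collected before it.\<close>

lemma partitions_nth_eq_0D:
  assumes x: "x \<in> partitions n" and j: "j < n" and zero: "x ! j = 0"
  shows "sum_list (take j x) = n"
proof -
  have "x ! i = 0" if "j \<le> i" "i < n" for i
    using partitions_nth_antimono[OF x that] zero by simp
  then have "\<forall>y\<in>set (drop j x). y = 0"
    using x by (auto simp: in_set_conv_nth partitions_def)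
  then have "sum_list (drop j x) = 0"
    by (simp add: sum_list_eq_0_iff)
  then show ?thesis
    using partitions_sum_take_drop[OF x, of j] by linarith
qed

text \<open>Comparing first entries gives one direction. Conversely, the partial sums of the hook
  start at \<open>k\<close> and rise by 1 up to \<open>n\<close>, while those of \<open>x\<close>
  start no lower and rise by at least 1 until they reach \<open>n\<close>.\<close>

lemma hook_dominance_le_iff:
  assumes x: "x \<in> partitions n" and k: "1 \<le> k" "k \<le> n"
  shows "dominance_le n (padded n (k # replicate (n - k) 1)) x \<longleftrightarrow> k \<le> x ! 0"
proof -
  have sum_g: "sum_list (take (Suc j) (padded n (k # replicate (n - k) 1))) = min n (k + j)" for j
    using k by (auto simp: sum_list_take_padded sum_list_replicate min_def)
  have n: "0 < n" "length x = n"
    using k x by (auto simp: partitions_def)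
  show ?thesis
  proof
    assume "dominance_le n (padded n (k # replicate (n - k) 1)) x"
    then have "sum_list (take (Suc 0) (padded n (k # replicate (n - k) 1)))
        \<le> sum_list (take (Suc 0) x)"
      using n by (auto simp: dominance_le_def)
    then show "k \<le> x ! 0"
      using k n sum_g[of 0] sum_list_take_Suc[of 0 x] by simp
  next
    assume kx: "k \<le> x ! 0"
    have "min n (k + j) \<le> sum_list (take (Suc j) x)" if "j < n" for j
      using that
    proof (induction j)
      case 0
      then show ?case
        using kx n sum_list_take_Suc[of 0 x] by simp
    next
      case (Suc j)
      show ?case
      proof (cases "x ! Suc j = 0")
        case True
        then show ?thesis
          using partitions_nth_eq_0D[OF x Suc.prems True] Suc.prems n
          by (simp add: sum_list_take_Suc)
      next
        case False
        then show ?thesis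
          using Suc n sum_list_take_Suc[of "Suc j" x] by simp
      qed
    qed
    then show "dominance_le n (padded n (k # replicate (n - k) 1)) x"
      unfolding dominance_le_def using sum_g
      by (metis Suc_le_eq Suc_pred' atLeastAtMost_iff not_less_eq_eq One_nat_def)
  qed
qed

text \<open>The first entry of \<open>x\<close> is its largest, so if it is at most \<open>c\<close>
  the partial sums are at most \<open>j * c\<close>, and never above \<open>n\<close>; those of the
  rectangle are \<open>j * c\<close> for \<open>t\<close> steps and then \<open>n\<close>. As
  \<open>t\<close> is at least 1, the first of them is \<open>c\<close>, which gives the other
  direction.\<close>

lemma dominance_le_rectangle_iff:
  assumes x: "x \<in> partitions n" and n: "0 < n" "n = t * c + r" and t: "1 \<le> t"
  shows "dominance_le n x (padded n (replicate t c @ [r])) \<longleftrightarrow> x ! 0 \<le> c"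
proof -
  have sum_m: "sum_list (take j (padded n (replicate t c @ [r]))) = (if j \<le> t then j * c else n)" for j
    using n by (auto simp: sum_list_take_padded sum_list_replicate min_def take_Cons')
  have len: "length x = n"
    using x by (auto simp: partitions_def)
  have bound: "sum_list (take j x) \<le> j * x ! 0" if "j \<le> n" for j
    using that
  proof (induction j)
    case (Suc j)
    then show ?case
      using partitions_nth_antimono[OF x, of 0 j] sum_list_take_Suc[of j x] len by simp
  qed simp
  show ?thesis
  proof
    assume "dominance_le n x (padded n (replicate t c @ [r]))"
    then have "sum_list (take (Suc 0) x)
        \<le> sum_list (take (Suc 0) (padded n (replicate t c @ [r])))"
      using n(1) unfolding dominance_le_def by simp
    then show "x ! 0 \<le> c"
      using t n len sum_m[of "Suc 0"] sum_list_take_Suc[of 0 x] by simp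
  next
    assume "x ! 0 \<le> c"
    then have "sum_list (take j x) \<le> j * c" if "j \<le> n" for j
      using bound[OF that] by (meson le_trans mult_le_mono2)
    then show "dominance_le n x (padded n (replicate t c @ [r]))"
      using partitions_sum_take_le[OF x] by (auto simp: dominance_le_def sum_m)
  qed
qed

text \<open>For \<open>t = 0\<close>, \<open>n = r\<close> would be less than
  \<open>k\<close>.\<close>

lemma quotient_positive:
  fixes n k t r :: nat
  assumes "2 \<le> k" "k \<le> n" "n = t * (k - 1) + r" "r \<le> k - 2"
  shows "1 \<le> t"
  using assms by (cases t) auto

text \<open>First entry at least \<open>k\<close> and first entry at most \<open>k - 1\<close> are
  complementary conditions. The bound on \<open>r\<close> makes the rectangle with its remainder
  weakly decreasing.\<close>

lemma splitting_pair_hook_rectangle: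
  fixes n k t r :: nat
  assumes k: "2 \<le> k" "k \<le> n" and n: "n = t * (k - 1) + r" and r: "r \<le> k - 2"
  shows "splitting_pair (dominance_lattice n)
    (padded n (k # replicate (n - k) 1)) (padded n (replicate t (k - 1) @ [r]))"
proof -
  have "padded n (k # replicate (n - k) 1) \<in> partitions n"
    using k by (intro padded_in_partitions)
      (auto simp: sum_list_replicate sorted_wrt_iff_nth_less[of _ "replicate _ _"])
  moreover have "padded n (replicate t (k - 1) @ [r]) \<in> partitions n"
    using n r by (intro padded_in_partitions)
      (auto simp: sum_list_replicate sorted_wrt_append sorted_wrt_iff_nth_less[of _ "replicate _ _"])
  moreover have "dominance_le n (padded n (k # replicate (n - k) 1)) x \<longleftrightarrow>
      \<not> dominance_le n x (padded n (replicate t (k - 1) @ [r]))" if "x \<in> partitions n" for x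
    using hook_dominance_le_iff[OF that, of k]
      dominance_le_rectangle_iff[OF that _ n quotient_positive[OF k n r]] k by auto
  ultimately show ?thesis
    by (simp add: splitting_pair_def)
qed

theorem theorem4p17:
  fixes n :: nat
  shows "(\<forall>k t r :: nat. 2 \<le> k \<and> k \<le> n \<and> n = t * (k - 1) + r \<and> r \<le> k - 2 \<longrightarrow>
            t \<ge> 1 \<and>
            padded n (k # replicate (n - k) 1) \<in> join_irreducibles (dominance_lattice n) \<and>
            padded n (replicate t (k - 1) @ [r]) \<in> meet_irreducibles (dominance_lattice n) \<and>
            arrow_down (dominance_lattice n)
              (padded n (k # replicate (n - k) 1)) (padded n (replicate t (k - 1) @ [r])) \<and>
            arrow_up (dominance_lattice n)
              (padded n (k # replicate (n - k) 1)) (padded n (replicate t (k - 1) @ [r]))) \<and>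
         (\<forall>g m. g \<in> join_irreducibles (dominance_lattice n) \<and> type_C n g \<and>
            m \<in> meet_irreducibles (dominance_lattice n) \<and>
            arrow_down (dominance_lattice n) g m \<and> arrow_up (dominance_lattice n) g m \<longrightarrow>
            (\<exists>k t r :: nat. 2 \<le> k \<and> k \<le> n \<and> n = t * (k - 1) + r \<and> r \<le> k - 2 \<and>
               g = padded n (k # replicate (n - k) 1) \<and>
               m = padded n (replicate t (k - 1) @ [r])))"
  proof -
  interpret complete_lattice "dominance_lattice n"
    by (rule complete_lattice_dominance_lattice)
  let ?g = "\<lambda>k. padded n (k # replicate (n - k) 1)"
  let ?m = "\<lambda>k t r. padded n (replicate t (k - 1) @ [r])"
  have first: "t \<ge> 1 \<and> ?g k \<in> join_irreducibles (dominance_lattice n) \<and>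
      ?m k t r \<in> meet_irreducibles (dominance_lattice n) \<and>
      arrow_down (dominance_lattice n) (?g k) (?m k t r) \<and>
      arrow_up (dominance_lattice n) (?g k) (?m k t r)"
    if "2 \<le> k \<and> k \<le> n \<and> n = t * (k - 1) + r \<and> r \<le> k - 2" for k t r
  proof -
    have "splitting_pair (dominance_lattice n) (?g k) (?m k t r)"
      using that splitting_pair_hook_rectangle by blast
    then show ?thesis
      using that quotient_positive splitting_pair_join_irreducible splitting_pair_meet_irreducible
        splitting_pair_arrow_down splitting_pair_arrow_up by blast
  qed
  have second: "\<exists>k t r. 2 \<le> k \<and> k \<le> n \<and> n = t * (k - 1) + r \<and> r \<le> k - 2 \<and>
      g = ?g k \<and> m = ?m k t r"
    if g: "type_C n g" and m: "m \<in> meet_irreducibles (dominance_lattice n)"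
      and arrow: "arrow_up (dominance_lattice n) g m" for g m
  proof -
    obtain k d where k: "3 \<le> k" and g_eq: "g = padded n (k # replicate d 1)"
      and "g \<in> partitions n"
      using g by (auto simp: type_C_def join_irreducibles_def)
    \<comment> \<open>Type C leaves \<open>d\<close> free; the sum of the entries pins it to
      \<open>n - k\<close>. The cutoff \<open>max (length g) (Suc d)\<close> is large enough to take
      both lists whole.\<close>
    have "sum_list g = k + d"
      using sum_list_take_padded[of "max (length g) (Suc d)" n "k # replicate d 1"]
      by (simp add: g_eq sum_list_replicate)
    with \<open>g \<in> partitions n\<close> have n: "n = k + d"
      by (simp add: partitions_def)
    \<comment> \<open>Division with remainder by \<open>k - 1\<close>, which is positive, produces
      the required shape.\<close>
    define t r where "t = n div (k - 1)" and "r = n mod (k - 1)"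
    have "r < k - 1"
      unfolding r_def using k by (intro mod_less_divisor) simp
    then have *: "2 \<le> k" "k \<le> n" "n = t * (k - 1) + r" "r \<le> k - 2"
      using k n div_mult_mod_eq[of n "k - 1"] unfolding t_def r_def by linarith+
    have "g = ?g k"
      using g_eq n by simp
    \<comment> \<open>The hook \<open>g\<close> and this rectangle form a splitting pair, so the
      target of an up-arrow from \<open>g\<close> can only be the rectangle.\<close>
    moreover have "m = ?m k t r"
      using splitting_pair_arrow_up_unique[OF _ splitting_pair_hook_rectangle[OF *] m]
        arrow calculation finite_partitions by simp
    ultimately show ?thesis
      using * by blast
  qed
  show ?thesis
    using first second by blast
qed

end
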